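(* The tensor product of two finite (not necessarily abelian) groups is finite. Moreover, let $P$ be the set of all prime numbers and let $A,B$ be finite abelian groups with primary decompositions $$A\cong\bigoplus_{p\in P}\Big(\bigoplus_{i\in A_p}\mathbb{Z}_{p^{i}}\Big),\qquad B\cong\bigoplus_{p\in P}\Big(\bigoplus_{j\in B_p}\mathbb{Z}_{p^{j}}\Big),$$ where for each $p\in P$, $A_p$ and $B_p$ are finite multisets of positive integers, all but finitely many of which are empty. Then the primary decomposition of $A\otimes B$ is given by $$A\otimes B\cong\bigoplus_{p\in P}\Big(\bigoplus_{i\in A_p}\bigoplus_{j\in B_p}\mathbb{Z}_{p^{\min(i,j)}}\Big).$$
   Context: $\mathbb{Z}_n$ denotes the cyclic group of integers modulo $n$. For groups $G,H,K$ (abelian or not), a map $f\colon G\times H\to K$ is bilinear if $f(g,\cdot)\colon H\to K$ and $f(\cdot,h)\colon G\to K$ are group homomorphisms for all $g\in G$, $h\in H$. The tensor product $G\otimes H$ of two groups (written multiplicatively) is the quotient $F(G\times H)/N$ of the free group $F(G\times H)$ on the set $G\times H$ by the normal subgroup $N$ generated by the elements $(gg',h)(g,h)^{-1}(g',h)^{-1}$ and $(g,hh')(g,h)^{-1}(g,h')^{-1}$ for all $g,g'\in G$, $h,h'\in H$. For abelian groups it coincides with $A\otimes_{\mathbb{Z}}B$. Direct sums over an empty index multiset are trivial. *)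

theory Defs
  imports "HOL-Algebra.Product_Groups" "HOL-Library.Multiset" "HOL-Computational_Algebra.Primes"
begin

section \<open>Free groups\<close>

text \<open>Words over \<open>S\<close> are lists of letters \<open>(x, b)\<close> with \<open>x \<in> S\<close>; the letter \<open>(x, True)\<close> stands for
  \<open>x\<close> and \<open>(x, False)\<close> for its formal inverse.\<close>

inductive_set free_rel :: "'a set \<Rightarrow> (('a \<times> bool) list \<times> ('a \<times> bool) list) set"
  for S :: "'a set" where
  refl: "w \<in> lists (S \<times> UNIV) \<Longrightarrow> (w, w) \<in> free_rel S"
| sym: "(v, w) \<in> free_rel S \<Longrightarrow> (w, v) \<in> free_rel S"
| trans: "(u, v) \<in> free_rel S \<Longrightarrow> (v, w) \<in> free_rel S \<Longrightarrow> (u, w) \<in> free_rel S"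
| cancel: "u \<in> lists (S \<times> UNIV) \<Longrightarrow> v \<in> lists (S \<times> UNIV) \<Longrightarrow> x \<in> S \<Longrightarrow>
    (u @ [(x, b), (x, \<not> b)] @ v, u @ v) \<in> free_rel S"

definition free_group :: "'a set \<Rightarrow> ('a \<times> bool) list set monoid" where
  "free_group S =
     \<lparr>carrier = lists (S \<times> UNIV) // free_rel S,
      monoid.mult = (\<lambda>U V. free_rel S `` {u @ v | u v. u \<in> U \<and> v \<in> V}),
      one = free_rel S `` {[]}\<rparr>"

definition free_gen :: "'a set \<Rightarrow> 'a \<Rightarrow> ('a \<times> bool) list set" where
  "free_gen S x = free_rel S `` {[(x, True)]}"

lemma free_rel_lists: "(u, v) \<in> free_rel S \<Longrightarrow> u \<in> lists (S \<times> UNIV) \<and> v \<in> lists (S \<times> UNIV)"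
  by (induction rule: free_rel.induct) auto

lemma equiv_free_rel: "equiv (lists (S \<times> UNIV)) (free_rel S)"
proof (rule equivI)
  show "refl_on (lists (S \<times> UNIV)) (free_rel S)"
    by (auto simp: refl_on_def intro: free_rel.refl)
qed (auto intro: symI transI free_rel.sym free_rel.trans dest: free_rel_lists)

lemma free_rel_append1:
  "(u, v) \<in> free_rel S \<Longrightarrow> w \<in> lists (S \<times> UNIV) \<Longrightarrow> (u @ w, v @ w) \<in> free_rel S"
proof (induction rule: free_rel.induct)
  case (cancel u v x b)
  then show ?case using free_rel.cancel[of u S "v @ w" x b] by simp
next
  case (refl w')
  then show ?case by (intro free_rel.refl) auto
qed (blast intro: free_rel.sym free_rel.trans)+

lemma free_rel_append2:
  "(u, v) \<in> free_rel S \<Longrightarrow> w \<in> lists (S \<times> UNIV) \<Longrightarrow> (w @ u, w @ v) \<in> free_rel S"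
proof (induction rule: free_rel.induct)
  case (cancel u v x b)
  then show ?case using free_rel.cancel[of "w @ u" S v x b] by simp
next
  case (refl w')
  then show ?case by (intro free_rel.refl) auto
qed (blast intro: free_rel.sym free_rel.trans)+

lemma free_rel_append:
  assumes "(u, u') \<in> free_rel S" "(v, v') \<in> free_rel S"
  shows "(u @ v, u' @ v') \<in> free_rel S"
  using assms free_rel_append1 free_rel_append2 free_rel_lists free_rel.trans by metis

lemma carrier_free_group: "carrier (free_group S) = lists (S \<times> UNIV) // free_rel S"
  by (simp add: free_group_def)

lemma one_free_group: "\<one>\<^bsub>free_group S\<^esub> = free_rel S `` {[]}"
  by (simp add: free_group_def)

lemma mult_free_group:
  assumes "u \<in> lists (S \<times> UNIV)" "v \<in> lists (S \<times> UNIV)"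
  shows "(free_rel S `` {u}) \<otimes>\<^bsub>free_group S\<^esub> (free_rel S `` {v}) = free_rel S `` {u @ v}"
proof -
  have "free_rel S `` {u' @ v' | u' v'. u' \<in> free_rel S `` {u} \<and> v' \<in> free_rel S `` {v}} =
        free_rel S `` {u @ v}" (is "?L = ?R")
  proof (intro equalityI subsetI)
    fix w assume "w \<in> ?L"
    then obtain u' v' where "(u, u') \<in> free_rel S" "(v, v') \<in> free_rel S" "(u' @ v', w) \<in> free_rel S"
      by blast
    then show "w \<in> ?R"
      using free_rel.trans[OF free_rel_append] by blast
  next
    fix w assume "w \<in> ?R"
    moreover have "(u, u) \<in> free_rel S" "(v, v) \<in> free_rel S"
      using assms by (auto intro: free_rel.refl simp del: in_lists_conv_set)
    ultimately show "w \<in> ?L" by blast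
  qed
  then show ?thesis by (simp add: free_group_def)
qed

lemma free_groupE:
  assumes "X \<in> carrier (free_group S)"
  obtains w where "w \<in> lists (S \<times> UNIV)" "X = free_rel S `` {w}"
  using assms unfolding carrier_free_group by (rule quotientE)

lemma free_class_closed: "w \<in> lists (S \<times> UNIV) \<Longrightarrow> free_rel S `` {w} \<in> carrier (free_group S)"
  unfolding carrier_free_group by (rule quotientI)

lemma free_rel_inverse:
  "w \<in> lists (S \<times> UNIV) \<Longrightarrow> (rev (map (\<lambda>(x, b). (x, \<not> b)) w) @ w, []) \<in> free_rel S"
proof (induction w)
  case Nil
  then show ?case by (simp add: free_rel.refl)
next
  case (Cons a w)
  obtain x b where a: "a = (x, b)" by fastforce
  let ?v = "rev (map (\<lambda>(x, b). (x, \<not> b)) w)"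
  have "?v \<in> lists (S \<times> UNIV)" using Cons by auto
  then have "(?v @ [(x, \<not> b), (x, \<not> \<not> b)] @ w, ?v @ w) \<in> free_rel S"
    using Cons by (intro free_rel.cancel) (auto simp: a)
  moreover have "(?v @ w, []) \<in> free_rel S" using Cons by simp
  ultimately show ?case using free_rel.trans by (fastforce simp: a)
qed

lemma group_free_group: "group (free_group S)"
proof (rule groupI)
  show "\<one>\<^bsub>free_group S\<^esub> \<in> carrier (free_group S)"
    unfolding one_free_group by (rule free_class_closed) simp
next
  fix X Y assume "X \<in> carrier (free_group S)" "Y \<in> carrier (free_group S)"
  then obtain u v where uv: "u \<in> lists (S \<times> UNIV)" "v \<in> lists (S \<times> UNIV)"
      "X = free_rel S `` {u}" "Y = free_rel S `` {v}"
    by (metis free_groupE)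
  then have "u @ v \<in> lists (S \<times> UNIV)" by auto
  then show "X \<otimes>\<^bsub>free_group S\<^esub> Y \<in> carrier (free_group S)"
    unfolding uv(3,4) mult_free_group[OF uv(1,2)] by (rule free_class_closed)
next
  fix X Y Z
  assume "X \<in> carrier (free_group S)" "Y \<in> carrier (free_group S)" "Z \<in> carrier (free_group S)"
  then obtain u v w where uvw: "u \<in> lists (S \<times> UNIV)" "v \<in> lists (S \<times> UNIV)" "w \<in> lists (S \<times> UNIV)"
      "X = free_rel S `` {u}" "Y = free_rel S `` {v}" "Z = free_rel S `` {w}"
    by (metis free_groupE)
  have "u @ v \<in> lists (S \<times> UNIV)" "v @ w \<in> lists (S \<times> UNIV)" using uvw(1-3) by auto
  then show "X \<otimes>\<^bsub>free_group S\<^esub> Y \<otimes>\<^bsub>free_group S\<^esub> Z =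
             X \<otimes>\<^bsub>free_group S\<^esub> (Y \<otimes>\<^bsub>free_group S\<^esub> Z)"
    unfolding uvw(4-6) using uvw(1-3) by (simp only: mult_free_group append_assoc)
next
  fix X assume "X \<in> carrier (free_group S)"
  then obtain w where w: "w \<in> lists (S \<times> UNIV)" "X = free_rel S `` {w}"
    by (rule free_groupE)
  have nil: "[] \<in> lists (S \<times> UNIV)" by simp
  show "\<one>\<^bsub>free_group S\<^esub> \<otimes>\<^bsub>free_group S\<^esub> X = X"
    unfolding w(2) one_free_group mult_free_group[OF nil w(1)] by simp
  let ?v = "rev (map (\<lambda>(x, b). (x, \<not> b)) w)"
  have v: "?v \<in> lists (S \<times> UNIV)" using w by auto
  have "free_rel S `` {?v @ w} = free_rel S `` {[]}"
    by (rule equiv_class_eq[OF equiv_free_rel free_rel_inverse[OF w(1)]])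
  then show "\<exists>Y\<in>carrier (free_group S). Y \<otimes>\<^bsub>free_group S\<^esub> X = \<one>\<^bsub>free_group S\<^esub>"
    unfolding w(2) one_free_group
    by (intro bexI[of _ "free_rel S `` {?v}"] free_class_closed v)
       (simp only: mult_free_group[OF v w(1)])
qed

lemma free_gen_closed: "x \<in> S \<Longrightarrow> free_gen S x \<in> carrier (free_group S)"
  unfolding free_gen_def by (rule free_class_closed) auto


section \<open>Normal closure and the tensor product\<close>

definition normal_closure :: "('a, 'm) monoid_scheme \<Rightarrow> 'a set \<Rightarrow> 'a set" where
  "normal_closure G R = \<Inter> {N. N \<lhd> G \<and> R \<subseteq> N}"

definition tensor_relators ::
  "('a, 'm) monoid_scheme \<Rightarrow> ('b, 'n) monoid_scheme \<Rightarrow> (('a \<times> 'b) \<times> bool) list set set" where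
  "tensor_relators G H =
     (let F = free_group (carrier G \<times> carrier H);
          e = (\<lambda>g h. free_gen (carrier G \<times> carrier H) (g, h))
      in {e (g \<otimes>\<^bsub>G\<^esub> g') h \<otimes>\<^bsub>F\<^esub> inv\<^bsub>F\<^esub> (e g h) \<otimes>\<^bsub>F\<^esub> inv\<^bsub>F\<^esub> (e g' h) | g g' h.
             g \<in> carrier G \<and> g' \<in> carrier G \<and> h \<in> carrier H}
       \<union> {e g (h \<otimes>\<^bsub>H\<^esub> h') \<otimes>\<^bsub>F\<^esub> inv\<^bsub>F\<^esub> (e g h) \<otimes>\<^bsub>F\<^esub> inv\<^bsub>F\<^esub> (e g h') | g h h'.
             g \<in> carrier G \<and> h \<in> carrier H \<and> h' \<in> carrier H})"

definition tensor_product ::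
  "('a, 'm) monoid_scheme \<Rightarrow> ('b, 'n) monoid_scheme \<Rightarrow> (('a \<times> 'b) \<times> bool) list set set monoid" where
  "tensor_product G H =
     (let F = free_group (carrier G \<times> carrier H)
      in F Mod normal_closure F (tensor_relators G H))"

lemma (in group) normal_closure_normal:
  assumes "R \<subseteq> carrier G"
  shows "normal_closure G R \<lhd> G"
proof -
  have "carrier G \<lhd> G"
    by (auto simp: normal_inv_iff subgroup_self)
  then have ne: "{N. N \<lhd> G \<and> R \<subseteq> N} \<noteq> {}" using assms by blast
  have "subgroup (normal_closure G R) G"
    unfolding normal_closure_def
    by (rule subgroups_Inter) (use ne normal_imp_subgroup in auto)
  then show ?thesis
    by (auto simp: normal_inv_iff normal_closure_def)
qed

lemma tensor_relators_closed:
  assumes "group G" "group H"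
  shows "tensor_relators G H \<subseteq> carrier (free_group (carrier G \<times> carrier H))"
proof -
  interpret G: group G by fact
  interpret H: group H by fact
  interpret F: group "free_group (carrier G \<times> carrier H)" by (rule group_free_group)
  show ?thesis
    by (auto simp: tensor_relators_def Let_def free_gen_closed)
qed

lemma group_tensor_product:
  assumes "group G" "group H"
  shows "group (tensor_product G H)"
  unfolding tensor_product_def Let_def
  by (intro normal.factorgroup_is_group group.normal_closure_normal group_free_group
      tensor_relators_closed assms)


section \<open>Direct sums indexed by multisets\<close>

text \<open>Each \<open>i\<close> contributes \<open>count M i\<close> summands \<open>G i\<close>, indexed by the pairs \<open>(i, k)\<close> with
  \<open>k < count M i\<close>.\<close>

definition multiset_sum_group ::
  "'i multiset \<Rightarrow> ('i \<Rightarrow> ('a, 'm) monoid_scheme) \<Rightarrow> ('i \<times> nat \<Rightarrow> 'a) monoid" where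
  "multiset_sum_group M G = sum_group {(i, k). k < count M i} (\<lambda>(i, k). G i)"

end

theory Submission
  imports Defs "HOL-Algebra.Free_Abelian_Groups" "HOL-Algebra.Multiplicative_Group"
begin

text \<open>The elementary tensors of \<open>G \<otimes> H\<close> commute with each other, so \<open>G \<otimes> H\<close> is an abelian group that is
  universal for bilinear maps into abelian groups. If \<open>G\<close> and \<open>H\<close> are finite, there are only finitely
  many elementary tensors and each of them has finite order, so \<open>G \<otimes> H\<close> is finite.

  By the universal property, the tensor product is symmetric and commutes with direct sums in both
  arguments, and \<open>\<int>\<^sub>m \<otimes> \<int>\<^sub>n \<cong> \<int>\<^bsub>gcd m n\<^esub>\<close> by Bezout's identity. Distributing over two primary
  decompositions leaves \<open>\<int>\<^bsub>gcd (p^i) (q^j)\<^esub>\<close>, which is trivial for \<open>p \<noteq> q\<close>.\<close>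

section \<open>Homomorphisms and generators\<close>

text \<open>The uniqueness half of the universal properties: homomorphisms out of direct sums and
  tensor products are compared on canonical generators only.\<close>

lemma hom_eq_on_generate:
  assumes "group G" "group H" "f \<in> hom G H" "g \<in> hom G H" "S \<subseteq> carrier G"
    and eq: "\<And>s. s \<in> S \<Longrightarrow> f s = g s" and x: "x \<in> generate G S"
  shows "f x = g x"
proof -
  interpret f: group_hom G H f
    using assms by (simp add: group_hom_def group_hom_axioms_def)
  interpret g: group_hom G H g
    using assms by (simp add: group_hom_def group_hom_axioms_def)
  have "x \<in> carrier G \<and> f x = g x"
    using x by induction (use assms(5) eq in auto)
  then show ?thesis ..
qed

text \<open>Adjoining a generator \<open>x\<close> multiplies the subgroup by the finite cyclic
  group of \<open>x\<close>; commutativity makes this product set a subgroup again.\<close>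

lemma (in comm_group) finite_generate_torsion:
  assumes "finite S" "S \<subseteq> carrier G" "\<And>x. x \<in> S \<Longrightarrow> \<exists>n>0. x [^] (n::nat) = \<one>"
  shows "finite (generate G S)"
  using assms
proof (induction S rule: finite_induct)
  case empty
  then show ?case by (simp add: generate_empty)
next
  case (insert x S)
  then have x: "x \<in> carrier G" and S: "S \<subseteq> carrier G" by auto
  obtain n :: nat where n: "n > 0" "x [^] n = \<one>" using insert.prems by blast
  \<comment> \<open>Reducing the exponent modulo \<open>n\<close> leaves at most \<open>n\<close>
    distinct powers of \<open>x\<close>.\<close>
  have "x [^] (k::int) \<in> (\<lambda>l::int. x [^] l) ` {0..<int n}" for k
  proof -
    have "x [^] k = x [^] (int n * (k div int n) + k mod int n)" by simp
    also have "\<dots> = (x [^] int n) [^] (k div int n) \<otimes> x [^] (k mod int n)"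
      by (simp only: int_pow_mult int_pow_pow x)
    also have "\<dots> = x [^] (k mod int n)"
      using n x by (simp add: int_pow_int)
    finally show ?thesis using n by auto
  qed
  then have "generate G {x} \<subseteq> (\<lambda>l::int. x [^] l) ` {0..<int n}"
    unfolding generate_pow[OF x] by blast
  then have "finite (generate G {x})" by (rule finite_subset) simp
  moreover have "finite (generate G S)" using insert by auto
  ultimately have "finite (generate G {x} <#> generate G S)"
    by (simp add: set_mult_def)
  moreover have "generate G (insert x S) \<subseteq> generate G {x} <#> generate G S"
  proof (rule generate_subgroup_incl)
    show "subgroup (generate G {x} <#> generate G S) G"
      using x S by (intro mult_subgroups generate_is_subgroup) auto
    have "x \<otimes> \<one> \<in> generate G {x} <#> generate G S"
      unfolding set_mult_def using generate.incl[of x "{x}"] generate.one by blast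
    moreover have "\<one> \<otimes> y \<in> generate G {x} <#> generate G S" if "y \<in> S" for y
      unfolding set_mult_def using generate.incl[OF that] generate.one by blast
    ultimately show "insert x S \<subseteq> generate G {x} <#> generate G S"
      using x S by (simp add: subset_iff)
  qed
  ultimately show ?case by (rule rev_finite_subset)
qed

text \<open>Centralizers are subgroups, so it suffices that they contain \<open>S\<close>. This is
  applied twice: to the centralizer of a generator, then to that of an arbitrary element.\<close>

lemma (in group) comm_group_if_generators_commute:
  assumes gen: "carrier G = generate G S"
    and comm: "\<And>x y. x \<in> S \<Longrightarrow> y \<in> S \<Longrightarrow> x \<otimes> y = y \<otimes> x"
  shows "comm_group G"
proof -
  have S: "S \<subseteq> carrier G" unfolding gen by (auto intro: generate.incl)
  have centralizer: "subgroup {x \<in> carrier G. x \<otimes> y = y \<otimes> x} G" if y: "y \<in> carrier G" for y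
  proof
    fix x assume "x \<in> {x \<in> carrier G. x \<otimes> y = y \<otimes> x}"
    then have x: "x \<in> carrier G" and "x \<otimes> y = y \<otimes> x" by auto
    \<comment> \<open>Multiplying by \<open>inv x\<close> on both sides turns the relation for
      \<open>x\<close> into the one for \<open>inv x\<close>.\<close>
    then have "inv x \<otimes> (x \<otimes> y) \<otimes> inv x = inv x \<otimes> (y \<otimes> x) \<otimes> inv x" by simp
    moreover have "inv x \<otimes> (x \<otimes> y) \<otimes> inv x = y \<otimes> inv x"
      using x y by (simp flip: m_assoc)
    moreover have "inv x \<otimes> (y \<otimes> x) \<otimes> inv x = inv x \<otimes> y"
      using x y by (simp add: m_assoc)
    ultimately show "inv x \<in> {x \<in> carrier G. x \<otimes> y = y \<otimes> x}"
      using x by simp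
  next
    fix a b assume "a \<in> {x \<in> carrier G. x \<otimes> y = y \<otimes> x}" "b \<in> {x \<in> carrier G. x \<otimes> y = y \<otimes> x}"
    then show "a \<otimes> b \<in> {x \<in> carrier G. x \<otimes> y = y \<otimes> x}"
      using y by simp (metis m_assoc)
  qed (use y in auto)
  have *: "x \<otimes> y = y \<otimes> x" if "x \<in> carrier G" "y \<in> S" for x y
  proof -
    have "y \<in> carrier G" using S that by blast
    then have "generate G S \<subseteq> {x \<in> carrier G. x \<otimes> y = y \<otimes> x}"
      using S comm that by (intro generate_subgroup_incl centralizer) auto
    then show ?thesis using gen that by blast
  qed
  have "x \<otimes> y = y \<otimes> x" if "x \<in> carrier G" "y \<in> carrier G" for x y
  proof -
    have "generate G S \<subseteq> {z \<in> carrier G. z \<otimes> y = y \<otimes> z}"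
      using S *[OF that(2)] that by (intro generate_subgroup_incl centralizer) auto
    then show ?thesis using gen that by blast
  qed
  then show ?thesis by (intro group_comm_groupI)
qed

section \<open>The universal property of the free group\<close>

text \<open>The homomorphism extending \<open>f\<close>, computed on representatives; it descends to
  classes because a cancelling pair of letters evaluates to the identity.\<close>

primrec word_eval :: "('b, 'm) monoid_scheme \<Rightarrow> ('a \<Rightarrow> 'b) \<Rightarrow> ('a \<times> bool) list \<Rightarrow> 'b" where
  "word_eval K f [] = \<one>\<^bsub>K\<^esub>"
| "word_eval K f (a # w) =
     (if snd a then f (fst a) else inv\<^bsub>K\<^esub> f (fst a)) \<otimes>\<^bsub>K\<^esub> word_eval K f w"

lemma (in group) word_eval_closed:
  "f \<in> S \<rightarrow> carrier G \<Longrightarrow> w \<in> lists (S \<times> UNIV) \<Longrightarrow> word_eval G f w \<in> carrier G"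
  by (induction w) (auto simp: Pi_iff)

lemma (in group) word_eval_append:
  "f \<in> S \<rightarrow> carrier G \<Longrightarrow> u \<in> lists (S \<times> UNIV) \<Longrightarrow> v \<in> lists (S \<times> UNIV) \<Longrightarrow>
   word_eval G f (u @ v) = word_eval G f u \<otimes> word_eval G f v"
proof (induction u)
  case Nil
  then show ?case using word_eval_closed[of f S v] by simp
next
  case (Cons a u)
  then have "word_eval G f u \<in> carrier G" "word_eval G f v \<in> carrier G" "f (fst a) \<in> carrier G"
    using word_eval_closed by (auto simp: Pi_iff)
  with Cons show ?case by (auto simp: m_assoc)
qed

lemma (in group) word_eval_cong:
  assumes "f \<in> S \<rightarrow> carrier G" "(u, v) \<in> free_rel S"
  shows "word_eval G f u = word_eval G f v"
  using assms(2)
proof induction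
  case (cancel u v x b)
  have "f x \<in> carrier G" "word_eval G f v \<in> carrier G"
    using cancel assms(1) word_eval_closed by auto
  then have "word_eval G f ([(x, b), (x, \<not> b)] @ v) = word_eval G f v"
    by (simp flip: m_assoc)
  moreover have "[(x, b), (x, \<not> b)] @ v \<in> lists (S \<times> UNIV)"
    using cancel by auto
  ultimately show ?case
    using cancel assms(1) by (simp only: word_eval_append)
qed auto

lemma (in group) free_group_universal:
  assumes f: "f \<in> S \<rightarrow> carrier G"
  obtains h where "h \<in> hom (free_group S) G" "\<And>x. x \<in> S \<Longrightarrow> h (free_gen S x) = f x"
proof
  \<comment> \<open>An arbitrary representative of the class is evaluated;
    \<open>word_eval_cong\<close> makes the choice immaterial.\<close>
  define h where "h = (\<lambda>X. word_eval G f (SOME w. w \<in> X))"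
  have h: "h (free_rel S `` {w}) = word_eval G f w" if "w \<in> lists (S \<times> UNIV)" for w
  proof -
    have "w \<in> free_rel S `` {w}"
      using free_rel.refl[OF that] by blast
    then have "(SOME w'. w' \<in> free_rel S `` {w}) \<in> free_rel S `` {w}"
      by (rule someI)
    then have "(w, SOME w'. w' \<in> free_rel S `` {w}) \<in> free_rel S"
      by blast
    from word_eval_cong[OF f this] show ?thesis
      by (simp add: h_def)
  qed
  show "h \<in> hom (free_group S) G"
  proof (rule homI)
    fix X assume "X \<in> carrier (free_group S)"
    then show "h X \<in> carrier G"
      by (elim free_groupE) (simp only: h word_eval_closed[OF f])
  next
    fix X Y assume "X \<in> carrier (free_group S)" "Y \<in> carrier (free_group S)"
    then obtain u v where uv: "u \<in> lists (S \<times> UNIV)" "v \<in> lists (S \<times> UNIV)"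
        "X = free_rel S `` {u}" "Y = free_rel S `` {v}"
      by (metis free_groupE)
    then have "u @ v \<in> lists (S \<times> UNIV)" by auto
    then show "h (X \<otimes>\<^bsub>free_group S\<^esub> Y) = h X \<otimes> h Y"
      unfolding uv(3,4) using uv(1,2) by (simp only: mult_free_group h word_eval_append[OF f])
  qed
  show "h (free_gen S x) = f x" if "x \<in> S" for x
  proof -
    have "[(x, True)] \<in> lists (S \<times> UNIV)" "f x \<in> carrier G" using f that by auto
    then show ?thesis by (simp add: free_gen_def h)
  qed
qed

lemma inv_free_gen:
  assumes "x \<in> S"
  shows "inv\<^bsub>free_group S\<^esub> free_gen S x = free_rel S `` {[(x, False)]}"
proof (rule group.inv_equality[OF group_free_group])
  have w: "[(x, False)] \<in> lists (S \<times> UNIV)" "[(x, True)] \<in> lists (S \<times> UNIV)"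
    using assms by auto
  have "([] @ [(x, False), (x, \<not> False)] @ [], [] @ []) \<in> free_rel S"
    using assms by (intro free_rel.cancel) auto
  then have "free_rel S `` {[(x, False)] @ [(x, True)]} = free_rel S `` {[]}"
    by (intro equiv_class_eq[OF equiv_free_rel]) simp
  then show "free_rel S `` {[(x, False)]} \<otimes>\<^bsub>free_group S\<^esub> free_gen S x = \<one>\<^bsub>free_group S\<^esub>"
    unfolding free_gen_def one_free_group by (simp only: mult_free_group[OF w])
  show "free_rel S `` {[(x, False)]} \<in> carrier (free_group S)"
    using w by (intro free_class_closed)
qed (rule free_gen_closed[OF assms])

text \<open>A class is the product of the classes of its letters, and by \<open>inv_free_gen\<close>
  each of these is a generator or the inverse of one.\<close>

lemma free_group_generated:
  "carrier (free_group S) = generate (free_group S) (free_gen S ` S)"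
proof
  interpret F: group "free_group S" by (rule group_free_group)
  show "generate (free_group S) (free_gen S ` S) \<subseteq> carrier (free_group S)"
    by (rule F.generate_incl) (auto simp: free_gen_closed)
  have "w \<in> lists (S \<times> UNIV) \<Longrightarrow> free_rel S `` {w} \<in> generate (free_group S) (free_gen S ` S)" for w
  proof (induction w)
    case Nil
    then show ?case using generate.one[of "free_group S"] by (simp add: one_free_group)
  next
    case (Cons a w)
    obtain x b where a: "a = (x, b)" by fastforce
    have x: "x \<in> S" and w: "w \<in> lists (S \<times> UNIV)" using Cons a by auto
    have "free_rel S `` {[a]} \<in> generate (free_group S) (free_gen S ` S)"
    proof (cases b)
      case True
      then show ?thesis using generate.incl[of "free_gen S x" "free_gen S ` S"] x
        by (auto simp: a free_gen_def)
    next
      case False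
      then show ?thesis using generate.inv[of "free_gen S x" "free_gen S ` S" "free_group S"] x
        by (auto simp: a inv_free_gen)
    qed
    from generate.eng[OF this Cons.IH[OF w]]
    have "free_rel S `` {[a] @ w} \<in> generate (free_group S) (free_gen S ` S)"
      using x w by (subst (asm) mult_free_group) (auto simp: a)
    then show ?case by simp
  qed
  then show "carrier (free_group S) \<subseteq> generate (free_group S) (free_gen S ` S)"
    by (auto elim!: free_groupE)
qed

section \<open>The universal property of the tensor product\<close>

definition bilinear_map ::
  "('a, 'm) monoid_scheme \<Rightarrow> ('b, 'n) monoid_scheme \<Rightarrow> ('c, 'k) monoid_scheme \<Rightarrow> ('a \<Rightarrow> 'b \<Rightarrow> 'c) \<Rightarrow> bool"
  where "bilinear_map G H K f \<longleftrightarrow>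
    (\<forall>h\<in>carrier H. (\<lambda>g. f g h) \<in> hom G K) \<and> (\<forall>g\<in>carrier G. f g \<in> hom H K)"

lemma bilinear_mapI:
  assumes "\<And>g h. g \<in> carrier G \<Longrightarrow> h \<in> carrier H \<Longrightarrow> f g h \<in> carrier K"
    and "\<And>g g' h. g \<in> carrier G \<Longrightarrow> g' \<in> carrier G \<Longrightarrow> h \<in> carrier H \<Longrightarrow>
          f (g \<otimes>\<^bsub>G\<^esub> g') h = f g h \<otimes>\<^bsub>K\<^esub> f g' h"
    and "\<And>g h h'. g \<in> carrier G \<Longrightarrow> h \<in> carrier H \<Longrightarrow> h' \<in> carrier H \<Longrightarrow>
          f g (h \<otimes>\<^bsub>H\<^esub> h') = f g h \<otimes>\<^bsub>K\<^esub> f g h'"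
  shows "bilinear_map G H K f"
  using assms by (auto simp: bilinear_map_def intro!: homI)

lemma bilinear_map_homs:
  assumes "bilinear_map G H K f"
  shows "h \<in> carrier H \<Longrightarrow> (\<lambda>g. f g h) \<in> hom G K" "g \<in> carrier G \<Longrightarrow> f g \<in> hom H K"
  using assms by (auto simp: bilinear_map_def)

text \<open>The elementary tensor of \<open>g\<close> and \<open>h\<close>: the coset of the
  corresponding free generator.\<close>

definition tensor ::
  "('a, 'm) monoid_scheme \<Rightarrow> ('b, 'n) monoid_scheme \<Rightarrow> 'a \<Rightarrow> 'b \<Rightarrow> (('a \<times> 'b) \<times> bool) list set set"
  where "tensor G H g h =
    (let F = free_group (carrier G \<times> carrier H)
     in normal_closure F (tensor_relators G H) #>\<^bsub>F\<^esub> free_gen (carrier G \<times> carrier H) (g, h))"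

section \<open>Elementary tensors: relations, generation and commutativity\<close>

locale group_pair = G: group G + H: group H
  for G :: "('a, 'm) monoid_scheme" and H :: "('b, 'n) monoid_scheme"
begin

abbreviation "F \<equiv> free_group (carrier G \<times> carrier H)"
abbreviation "e g h \<equiv> free_gen (carrier G \<times> carrier H) (g, h)"
abbreviation "N \<equiv> normal_closure F (tensor_relators G H)"
abbreviation "T \<equiv> tensor_product G H"
abbreviation "t \<equiv> tensor G H"

sublocale F: group F by (rule group_free_group)

lemma tensor_relators_subset: "tensor_relators G H \<subseteq> carrier F"
  by (rule tensor_relators_closed) (fact G.is_group, fact H.is_group)

sublocale N: normal N F
  by (rule F.normal_closure_normal[OF tensor_relators_subset])

sublocale T: group T
  by (rule group_tensor_product) (fact G.is_group, fact H.is_group)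

lemma tensor_product_eq: "T = F Mod N"
  by (simp add: tensor_product_def Let_def)

lemma coset_hom: "(\<lambda>x. N #>\<^bsub>F\<^esub> x) \<in> hom F T"
  unfolding tensor_product_eq by (rule N.r_coset_hom_Mod)

sublocale C: group_hom F T "\<lambda>x. N #>\<^bsub>F\<^esub> x"
  using coset_hom by unfold_locales

lemma tensor_eq: "t g h = N #>\<^bsub>F\<^esub> e g h"
  by (simp add: tensor_def Let_def)

lemma e_closed: "g \<in> carrier G \<Longrightarrow> h \<in> carrier H \<Longrightarrow> e g h \<in> carrier F"
  by (simp add: free_gen_closed)

lemma tensor_closed [simp]: "g \<in> carrier G \<Longrightarrow> h \<in> carrier H \<Longrightarrow> t g h \<in> carrier T"
  unfolding tensor_eq by (intro C.hom_closed e_closed)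

lemma coset_relator:
  assumes "r \<in> tensor_relators G H"
  shows "N #>\<^bsub>F\<^esub> r = \<one>\<^bsub>T\<^esub>"
proof -
  have "r \<in> N" using assms by (auto simp: normal_closure_def)
  then show ?thesis
    by (simp add: tensor_product_eq F.coset_join2 N.subgroup_axioms N.subset[THEN subsetD])
qed

text \<open>The relators reverse the order of the factors; this is immaterial only once \<open>T\<close> is known to be
  abelian.\<close>

lemma tensor_mult_left_rev:
  assumes "g \<in> carrier G" "g' \<in> carrier G" "h \<in> carrier H"
  shows "t (g \<otimes>\<^bsub>G\<^esub> g') h = t g' h \<otimes>\<^bsub>T\<^esub> t g h"
proof -
  have "e (g \<otimes>\<^bsub>G\<^esub> g') h \<otimes>\<^bsub>F\<^esub> inv\<^bsub>F\<^esub> (e g h) \<otimes>\<^bsub>F\<^esub> inv\<^bsub>F\<^esub> (e g' h) \<in> tensor_relators G H"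
    using assms unfolding tensor_relators_def Let_def by blast
  from coset_relator[OF this] assms
  have "t (g \<otimes>\<^bsub>G\<^esub> g') h \<otimes>\<^bsub>T\<^esub> inv\<^bsub>T\<^esub> (t g h) \<otimes>\<^bsub>T\<^esub> inv\<^bsub>T\<^esub> (t g' h) = \<one>\<^bsub>T\<^esub>"
    unfolding tensor_eq by (simp add: e_closed)
  \<comment> \<open>The product of \<open>inv a\<close> and \<open>inv b\<close> is the inverse of
    \<open>b\<close> times \<open>a\<close>; this is where the order of the factors gets
    reversed.\<close>
  then have "t (g \<otimes>\<^bsub>G\<^esub> g') h \<otimes>\<^bsub>T\<^esub> inv\<^bsub>T\<^esub> (t g' h \<otimes>\<^bsub>T\<^esub> t g h) = \<one>\<^bsub>T\<^esub>"
    using assms by (simp add: T.inv_mult_group T.m_assoc)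
  then show ?thesis
    using assms by (metis T.inv_closed T.inv_equality T.inv_inv T.m_closed tensor_closed G.m_closed)
qed

lemma tensor_mult_right_rev:
  assumes "g \<in> carrier G" "h \<in> carrier H" "h' \<in> carrier H"
  shows "t g (h \<otimes>\<^bsub>H\<^esub> h') = t g h' \<otimes>\<^bsub>T\<^esub> t g h"
proof -
  have "e g (h \<otimes>\<^bsub>H\<^esub> h') \<otimes>\<^bsub>F\<^esub> inv\<^bsub>F\<^esub> (e g h) \<otimes>\<^bsub>F\<^esub> inv\<^bsub>F\<^esub> (e g h') \<in> tensor_relators G H"
    using assms unfolding tensor_relators_def Let_def by blast
  from coset_relator[OF this] assms
  have "t g (h \<otimes>\<^bsub>H\<^esub> h') \<otimes>\<^bsub>T\<^esub> inv\<^bsub>T\<^esub> (t g h) \<otimes>\<^bsub>T\<^esub> inv\<^bsub>T\<^esub> (t g h') = \<one>\<^bsub>T\<^esub>"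
    unfolding tensor_eq by (simp add: e_closed)
  then have "t g (h \<otimes>\<^bsub>H\<^esub> h') \<otimes>\<^bsub>T\<^esub> inv\<^bsub>T\<^esub> (t g h' \<otimes>\<^bsub>T\<^esub> t g h) = \<one>\<^bsub>T\<^esub>"
    using assms by (simp add: T.inv_mult_group T.m_assoc)
  then show ?thesis
    using assms by (metis T.inv_closed T.inv_equality T.inv_inv T.m_closed tensor_closed H.m_closed)
qed

text \<open>The quotient map is surjective and takes the free generators, which generate
  \<open>F\<close>, to the elementary tensors.\<close>

lemma tensor_product_generated:
  "carrier T = generate T {t g h | g h. g \<in> carrier G \<and> h \<in> carrier H}"
proof -
  have "carrier T = (\<lambda>x. N #>\<^bsub>F\<^esub> x) ` carrier F"
    by (simp add: tensor_product_eq carrier_FactGroup)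
  also have "\<dots> = generate T ((\<lambda>x. N #>\<^bsub>F\<^esub> x) ` (free_gen (carrier G \<times> carrier H) ` (carrier G \<times> carrier H)))"
    unfolding free_group_generated
    by (rule C.generate_img[symmetric]) (auto simp: e_closed)
  also have "(\<lambda>x. N #>\<^bsub>F\<^esub> x) ` (free_gen (carrier G \<times> carrier H) ` (carrier G \<times> carrier H)) =
    {t g h | g h. g \<in> carrier G \<and> h \<in> carrier H}"
    by (auto simp: tensor_eq)
  finally show ?thesis .
qed

text \<open>Expanding \<open>t (g \<otimes> g') (h \<otimes> h')\<close> first in \<open>g\<close> and first in \<open>h\<close> gives two products of the same
  four factors that differ only by a swap of the two in the middle.\<close>

lemma tensor_commute:
  assumes "g \<in> carrier G" "g' \<in> carrier G" "h \<in> carrier H" "h' \<in> carrier H"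
  shows "t g h \<otimes>\<^bsub>T\<^esub> t g' h' = t g' h' \<otimes>\<^bsub>T\<^esub> t g h"
proof -
  \<comment> \<open>Under the reversed rules, putting \<open>g'\<close> before \<open>g\<close>
    makes \<open>t g h\<close> and \<open>t g' h'\<close> the two middle factors.\<close>
  have "t (g' \<otimes>\<^bsub>G\<^esub> g) (h \<otimes>\<^bsub>H\<^esub> h') = t g h' \<otimes>\<^bsub>T\<^esub> t g h \<otimes>\<^bsub>T\<^esub> (t g' h' \<otimes>\<^bsub>T\<^esub> t g' h)"
    using assms by (subst tensor_mult_left_rev) (auto simp: tensor_mult_right_rev)
  moreover have "t (g' \<otimes>\<^bsub>G\<^esub> g) (h \<otimes>\<^bsub>H\<^esub> h') = t g h' \<otimes>\<^bsub>T\<^esub> t g' h' \<otimes>\<^bsub>T\<^esub> (t g h \<otimes>\<^bsub>T\<^esub> t g' h)"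
    using assms by (subst tensor_mult_right_rev) (auto simp: tensor_mult_left_rev)
  ultimately have "t g h' \<otimes>\<^bsub>T\<^esub> (t g h \<otimes>\<^bsub>T\<^esub> t g' h' \<otimes>\<^bsub>T\<^esub> t g' h) =
      t g h' \<otimes>\<^bsub>T\<^esub> (t g' h' \<otimes>\<^bsub>T\<^esub> t g h \<otimes>\<^bsub>T\<^esub> t g' h)"
    using assms by (simp add: T.m_assoc)
  then show ?thesis using assms by simp
qed

lemma comm_group_tensor_product: "comm_group T"
  by (rule T.comm_group_if_generators_commute[OF tensor_product_generated]) (auto simp only: mem_Collect_eq tensor_commute)

sublocale T: comm_group T by (rule comm_group_tensor_product)

lemma bilinear_tensor: "bilinear_map G H T t"
  by (rule bilinear_mapI) (auto simp: tensor_mult_left_rev tensor_mult_right_rev T.m_comm)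

text \<open>The map \<open>f\<close> extends to the free group; its extension kills the relators and
  therefore factors through the quotient by \<open>N\<close>.\<close>

lemma tensor_product_universal:
  assumes "comm_group K" and f: "bilinear_map G H K f"
  obtains \<phi> where "\<phi> \<in> hom T K"
    "\<And>g h. g \<in> carrier G \<Longrightarrow> h \<in> carrier H \<Longrightarrow> \<phi> (t g h) = f g h"
proof -
  interpret K: comm_group K by fact
  have closed: "f g h \<in> carrier K" if "g \<in> carrier G" "h \<in> carrier H" for g h
    using hom_in_carrier[OF bilinear_map_homs(2)[OF f that(1)] that(2)] .
  obtain \<psi> where \<psi>: "\<psi> \<in> hom F K"
    and \<psi>_gen: "\<And>x. x \<in> carrier G \<times> carrier H \<Longrightarrow> \<psi> (free_gen (carrier G \<times> carrier H) x) = (case x of (g, h) \<Rightarrow> f g h)"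
    by (rule K.free_group_universal[of "\<lambda>(g, h). f g h" "carrier G \<times> carrier H"]) (auto simp: closed)
  interpret \<psi>: group_hom F K \<psi>
    using \<psi> by unfold_locales
  have left: "f (g \<otimes>\<^bsub>G\<^esub> g') h = f g h \<otimes>\<^bsub>K\<^esub> f g' h"
    if "g \<in> carrier G" "g' \<in> carrier G" "h \<in> carrier H" for g g' h
    using hom_mult[OF bilinear_map_homs(1)[OF f that(3)] that(1,2)] .
  have right: "f g (h \<otimes>\<^bsub>H\<^esub> h') = f g h \<otimes>\<^bsub>K\<^esub> f g h'"
    if "g \<in> carrier G" "h \<in> carrier H" "h' \<in> carrier H" for g h h'
    using hom_mult[OF bilinear_map_homs(2)[OF f that(1)] that(2,3)] .
  \<comment> \<open>By bilinearity a relator is sent to a commutator, which is trivial because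
    \<open>K\<close> is abelian.\<close>
  have cancel: "a \<otimes>\<^bsub>K\<^esub> b \<otimes>\<^bsub>K\<^esub> inv\<^bsub>K\<^esub> a \<otimes>\<^bsub>K\<^esub> inv\<^bsub>K\<^esub> b = \<one>\<^bsub>K\<^esub>"
    if "a \<in> carrier K" "b \<in> carrier K" for a b
    using that by (simp add: K.m_comm[of a b] K.m_assoc)
  have "\<psi> r = \<one>\<^bsub>K\<^esub>" if "r \<in> tensor_relators G H" for r
    using that unfolding tensor_relators_def Let_def
    by (auto simp: e_closed \<psi>_gen left right cancel closed)
  then have "tensor_relators G H \<subseteq> kernel F K \<psi>"
    using tensor_relators_subset by (auto simp: kernel_def)
  \<comment> \<open>The kernel is one of the normal subgroups whose intersection defines
    \<open>N\<close>.\<close>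
  then have "N \<subseteq> kernel F K \<psi>"
    unfolding normal_closure_def using \<psi>.normal_kernel by blast
  from \<psi>.FactGroup_universal_kernel[OF N.normal_axioms this]
  obtain \<phi> where "\<phi> \<in> hom T K" "\<And>x. x \<in> carrier F \<Longrightarrow> \<phi> (N #>\<^bsub>F\<^esub> x) = \<psi> x"
    unfolding tensor_product_eq by blast
  then show thesis
    by (intro that[of \<phi>]) (auto simp: tensor_eq e_closed \<psi>_gen)
qed

text \<open>The criterion behind the isomorphisms below. The map \<open>\<phi>\<close> induced by
  \<open>f\<close> is injective since \<open>r\<close> inverts it on elementary tensors, and
  surjective since its image contains the generators \<open>f g h\<close>. Thus
  \<open>\<phi> \<circ> r\<close> never has to be computed.\<close>

lemma tensor_product_iso:
  assumes K: "comm_group K" and f: "bilinear_map G H K f" and r: "r \<in> hom K T"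
    and rf: "\<And>g h. g \<in> carrier G \<Longrightarrow> h \<in> carrier H \<Longrightarrow> r (f g h) = t g h"
    and gen: "carrier K \<subseteq> generate K {f g h | g h. g \<in> carrier G \<and> h \<in> carrier H}"
  shows "T \<cong> K"
proof -
  interpret K: comm_group K by fact
  let ?S = "{t g h | g h. g \<in> carrier G \<and> h \<in> carrier H}"
  obtain \<phi> where \<phi>: "\<phi> \<in> hom T K"
    and \<phi>t: "\<And>g h. g \<in> carrier G \<Longrightarrow> h \<in> carrier H \<Longrightarrow> \<phi> (t g h) = f g h"
    using tensor_product_universal[OF K f] by blast
  interpret \<phi>: group_hom T K \<phi> using \<phi> by unfold_locales
  have inverse: "(r \<circ> \<phi>) x = id x" if "x \<in> carrier T" for x
  proof (rule hom_eq_on_generate[where f = "r \<circ> \<phi>" and g = id and S = ?S, OF T.is_group T.is_group])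
    show "r \<circ> \<phi> \<in> hom T T" by (rule hom_compose[OF \<phi> r])
    show "id \<in> hom T T" by (simp add: hom_def)
    show "x \<in> generate T ?S" using that by (simp flip: tensor_product_generated)
  qed (auto simp: \<phi>t rf)
  have "inj_on \<phi> (carrier T)"
    by (rule inj_on_inverseI[of _ r]) (use inverse in simp)
  moreover have "\<phi> ` carrier T = carrier K"
  proof
    have "carrier K \<subseteq> generate K (\<phi> ` ?S)"
    proof -
      have "{f g h | g h. g \<in> carrier G \<and> h \<in> carrier H} = \<phi> ` ?S"
        by (force simp: \<phi>t)
      then show ?thesis using gen by simp
    qed
    also have "generate K (\<phi> ` ?S) = \<phi> ` generate T ?S"
      by (rule \<phi>.generate_img) auto
    also have "\<dots> = \<phi> ` carrier T" by (simp flip: tensor_product_generated)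
    finally show "carrier K \<subseteq> \<phi> ` carrier T" .
  qed auto
  ultimately show ?thesis
    using \<phi> by (intro is_isoI isoI) (auto simp: bij_betw_def)
qed

section \<open>Finiteness of the tensor product of finite groups\<close>

lemma finite_tensor_product:
  assumes "finite (carrier G)" "finite (carrier H)"
  shows "finite (carrier T)"
proof -
  let ?S = "{t g h | g h. g \<in> carrier G \<and> h \<in> carrier H}"
  have "?S = (\<lambda>(g, h). t g h) ` (carrier G \<times> carrier H)" by auto
  then have "finite ?S" using assms by simp
  moreover have "\<exists>n>0. x [^]\<^bsub>T\<^esub> (n::nat) = \<one>\<^bsub>T\<^esub>" if "x \<in> ?S" for x
  proof -
    from that obtain g h where gh: "g \<in> carrier G" "h \<in> carrier H" "x = t g h" by blast
    \<comment> \<open>For fixed \<open>h\<close> the tensor is a homomorphism in \<open>g\<close>,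
      so the exponent \<open>order G\<close>, which kills \<open>g\<close>, also kills
      \<open>t g h\<close>.\<close>
    interpret h: group_hom G T "\<lambda>g. t g h"
      using bilinear_map_homs(1)[OF bilinear_tensor gh(2)] by unfold_locales
    have "x [^]\<^bsub>T\<^esub> order G = t (g [^]\<^bsub>G\<^esub> order G) h"
      using gh by (simp add: h.hom_nat_pow)
    also have "\<dots> = \<one>\<^bsub>T\<^esub>"
      using gh by (simp add: G.pow_order_eq_1)
    finally show ?thesis
      using assms(1) G.order_gt_0_iff_finite by blast
  qed
  ultimately show ?thesis
    by (subst tensor_product_generated) (auto intro!: T.finite_generate_torsion)
qed

end

section \<open>Direct sums\<close>

text \<open>The canonical inclusion of the \<open>i\<close>-th summand. It is restricted to
  \<open>I\<close> because elements of the direct sum are extensional functions.\<close>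

definition sum_inj :: "'i set \<Rightarrow> ('i \<Rightarrow> ('a, 'm) monoid_scheme) \<Rightarrow> 'i \<Rightarrow> 'a \<Rightarrow> 'i \<Rightarrow> 'a" where
  "sum_inj I G i g = (\<lambda>j\<in>I. if j = i then g else \<one>\<^bsub>G j\<^esub>)"

lemma sum_inj_hom:
  assumes "\<And>i. i \<in> I \<Longrightarrow> group (G i)" "i \<in> I"
  shows "sum_inj I G i \<in> hom (G i) (sum_group I G)"
proof (rule homI)
  interpret group "G i" using assms by blast
  fix x y assume "x \<in> carrier (G i)" "y \<in> carrier (G i)"
  moreover have "\<one>\<^bsub>G j\<^esub> \<otimes>\<^bsub>G j\<^esub> \<one>\<^bsub>G j\<^esub> = \<one>\<^bsub>G j\<^esub>" if "j \<in> I" for j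
    using assms(1)[OF that] by (simp add: group.is_monoid)
  ultimately show "sum_inj I G i (x \<otimes>\<^bsub>G i\<^esub> y) = sum_inj I G i x \<otimes>\<^bsub>sum_group I G\<^esub> sum_inj I G i y"
    by (auto simp: sum_inj_def intro!: restrict_ext)
next
  fix x assume x: "x \<in> carrier (G i)"
  have "{j \<in> I. sum_inj I G i x j \<noteq> \<one>\<^bsub>G j\<^esub>} \<subseteq> {i}"
    by (auto simp: sum_inj_def)
  then have "finite {j \<in> I. sum_inj I G i x j \<noteq> \<one>\<^bsub>G j\<^esub>}"
    by (rule finite_subset) simp
  moreover have "sum_inj I G i x \<in> (\<Pi>\<^sub>E j\<in>I. carrier (G j))"
    using x assms by (auto simp: sum_inj_def group.is_monoid)
  ultimately show "sum_inj I G i x \<in> carrier (sum_group I G)"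
    using assms by (simp add: carrier_sum_group)
qed

text \<open>Elements have finite support, so they are built up from the summands by splitting off
  one coordinate at a time.\<close>

lemma sum_group_generated:
  assumes grp: "\<And>i. i \<in> I \<Longrightarrow> group (G i)"
  shows "carrier (sum_group I G) =
    generate (sum_group I G) (\<Union>i\<in>I. sum_inj I G i ` carrier (G i))" (is "_ = generate _ ?S")
proof
  interpret S: group "sum_group I G" using grp by simp
  show "generate (sum_group I G) ?S \<subseteq> carrier (sum_group I G)"
    by (rule S.generate_incl) (auto intro: hom_in_carrier[OF sum_inj_hom[OF grp]])
  \<comment> \<open>The support is only required to lie inside \<open>J\<close>, so that the
    induction may run over arbitrary finite sets \<open>J\<close>.\<close>
  have "x \<in> generate (sum_group I G) ?S"
    if "finite J" "J \<subseteq> I" "x \<in> carrier (sum_group I G)" "{i \<in> I. x i \<noteq> \<one>\<^bsub>G i\<^esub>} \<subseteq> J" for J x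
    using that
  proof (induction J arbitrary: x rule: finite_induct)
    case empty
    then have "x = \<one>\<^bsub>sum_group I G\<^esub>"
      using grp by (auto simp: carrier_sum_group fun_eq_iff PiE_iff extensional_def)
    then show ?case using generate.one by metis
  next
    case (insert i J)
    have i: "i \<in> I" and J: "J \<subseteq> I" using insert by auto
    have x: "x \<in> (\<Pi>\<^sub>E j\<in>I. carrier (G j))" and fin: "finite {j \<in> I. x j \<noteq> \<one>\<^bsub>G j\<^esub>}"
      using insert.prems grp by (auto simp: carrier_sum_group)
    \<comment> \<open>Resetting coordinate \<open>i\<close> to the identity moves the support into
      \<open>J\<close>; multiplying by the included \<open>x i\<close> restores
      \<open>x\<close>.\<close>
    let ?y = "x(i := \<one>\<^bsub>G i\<^esub>)"
    have "{j \<in> I. ?y j \<noteq> \<one>\<^bsub>G j\<^esub>} \<subseteq> {j \<in> I. x j \<noteq> \<one>\<^bsub>G j\<^esub>}" by auto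
    then have "finite {j \<in> I. ?y j \<noteq> \<one>\<^bsub>G j\<^esub>}" using fin by (rule finite_subset)
    moreover have "?y \<in> (\<Pi>\<^sub>E j\<in>I. carrier (G j))"
      using x i grp[OF i] by (auto simp: PiE_iff extensional_def group.is_monoid)
    ultimately have "?y \<in> carrier (sum_group I G)"
      using grp by (simp add: carrier_sum_group)
    moreover have "{j \<in> I. ?y j \<noteq> \<one>\<^bsub>G j\<^esub>} \<subseteq> J" using insert.prems by auto
    ultimately have y: "?y \<in> generate (sum_group I G) ?S"
      by (rule insert.IH[OF J])
    have "sum_inj I G i (x i) \<in> ?S" using x i by auto
    then have "sum_inj I G i (x i) \<in> generate (sum_group I G) ?S" by (rule generate.incl)
    from generate.eng[OF this y]
    have "sum_inj I G i (x i) \<otimes>\<^bsub>sum_group I G\<^esub> ?y \<in> generate (sum_group I G) ?S" .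
    moreover have "sum_inj I G i (x i) \<otimes>\<^bsub>sum_group I G\<^esub> ?y = x"
    proof
      fix j
      show "(sum_inj I G i (x i) \<otimes>\<^bsub>sum_group I G\<^esub> ?y) j = x j"
      proof (cases "j \<in> I")
        case True
        then have "monoid (G j)" "x j \<in> carrier (G j)"
          using grp[OF True] x by (auto simp: group.is_monoid)
        then show ?thesis using True by (auto simp: sum_inj_def monoid.r_one)
      next
        case False
        then show ?thesis using PiE_arb[OF x False] by simp
      qed
    qed
    ultimately show ?case by simp
  qed
  then show "carrier (sum_group I G) \<subseteq> generate (sum_group I G) ?S"
    using grp by (auto simp: carrier_sum_group)
qed

text \<open>Both sides are homomorphisms in \<open>x\<close>, so they need only agree on the
  included summands. \<open>gfinprod\<close> multiplies the nontrivial factors, which gives the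
  product a meaning for infinite \<open>I\<close>.\<close>

lemma (in comm_group) hom_sum_group_eq_gfinprod:
  assumes grp: "\<And>i. i \<in> I \<Longrightarrow> group (A i)" and h: "h \<in> hom (sum_group I A) G"
    and x: "x \<in> carrier (sum_group I A)"
  shows "h x = gfinprod G (\<lambda>i. h (sum_inj I A i (x i))) I"
proof -
  interpret S: group "sum_group I A" using grp by simp
  have comp: "(\<lambda>a. h (sum_inj I A i a)) \<in> hom (A i) G" if "i \<in> I" for i
    using Group.hom_compose[OF sum_inj_hom[of I A, OF grp that] h] by (simp add: comp_def)
  have eq: "h y = gfinprod G (\<lambda>j. h (sum_inj I A j (y j))) I"
    if "i \<in> I" "a \<in> carrier (A i)" "y = sum_inj I A i a" for y i a
  proof -
    have triv: "h (sum_inj I A j \<one>\<^bsub>A j\<^esub>) = \<one>" if "j \<in> I" for j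
      using hom_one[OF comp[OF that] grp[OF that] is_group] .
    have clos: "(\<lambda>j. h (sum_inj I A j (y j))) \<in> I \<rightarrow> carrier G"
    proof
      fix j assume j: "j \<in> I"
      then have "y j \<in> carrier (A j)"
        using that grp[OF j] by (auto simp: sum_inj_def group.is_monoid)
      then show "h (sum_inj I A j (y j)) \<in> carrier G" by (rule hom_in_carrier[OF comp[OF j]])
    qed
    \<comment> \<open>For \<open>y\<close> in the \<open>i\<close>-th summand every factor with
      index other than \<open>i\<close> is trivial.\<close>
    have "gfinprod G (\<lambda>j. h (sum_inj I A j (y j))) I = gfinprod G (\<lambda>j. h (sum_inj I A j (y j))) {i}"
      by (rule gfinprod_mono_neutral_cong_right)
         (use that clos in \<open>auto simp: triv sum_inj_def[of I A i a]\<close>)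
    also have "\<dots> = finprod G (\<lambda>j. h (sum_inj I A j (y j))) {i}"
      using clos that(1) by (intro gfinprod_eq_finprod) auto
    also have "\<dots> = h (sum_inj I A i (y i))"
      using clos that(1) funcset_mem[OF clos that(1)] by simp
    also have "\<dots> = h y"
      using that by (simp add: sum_inj_def[of I A i a])
    finally show ?thesis by simp
  qed
  show ?thesis
  proof (rule hom_eq_on_generate[where f = h and g = "\<lambda>x. gfinprod G (\<lambda>i. h (sum_inj I A i (x i))) I"])
    show "(\<lambda>x. gfinprod G (\<lambda>i. h (sum_inj I A i (x i))) I) \<in> hom (sum_group I A) G"
      using hom_group_sum[of I "\<lambda>i a. h (sum_inj I A i a)" A, OF comp grp] .
    show "x \<in> generate (sum_group I A) (\<Union>i\<in>I. sum_inj I A i ` carrier (A i))"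
      using x sum_group_generated[of I A] grp by simp
    show "(\<Union>i\<in>I. sum_inj I A i ` carrier (A i)) \<subseteq> carrier (sum_group I A)"
      using hom_in_carrier[OF sum_inj_hom[of I A]] grp by blast
    show "h y = gfinprod G (\<lambda>i. h (sum_inj I A i (y i))) I"
      if "y \<in> (\<Union>i\<in>I. sum_inj I A i ` carrier (A i))" for y
      using that eq by blast
  qed (fact S.is_group is_group h)+
qed

section \<open>Commutative and trivial direct sums, and sums with one essential summand\<close>

lemma comm_group_sum_group:
  assumes "\<And>i. i \<in> I \<Longrightarrow> comm_group (G i)"
  shows "comm_group (sum_group I G)"
proof (rule group.group_comm_groupI)
  have grp: "\<And>i. i \<in> I \<Longrightarrow> group (G i)"
    using assms by (simp add: comm_group.axioms)
  show "group (sum_group I G)" using grp by simp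
  fix x y assume "x \<in> carrier (sum_group I G)" "y \<in> carrier (sum_group I G)"
  then have "x i \<in> carrier (G i)" "y i \<in> carrier (G i)" if "i \<in> I" for i
    using that grp by (auto simp: carrier_sum_group)
  then show "x \<otimes>\<^bsub>sum_group I G\<^esub> y = y \<otimes>\<^bsub>sum_group I G\<^esub> x"
    using assms by (auto intro!: restrict_ext simp: comm_monoid.m_comm comm_group.axioms(1))
qed

lemma trivial_sum_group:
  assumes "\<And>i. i \<in> I \<Longrightarrow> trivial_group (G i)"
  shows "trivial_group (sum_group I G)"
proof -
  have "trivial_group (product_group I G)"
    using assms by (simp add: trivial_product_group)
  moreover have grp: "\<And>i. i \<in> I \<Longrightarrow> group (G i)"
    using assms by (simp add: trivial_group_def)
  moreover have "group (sum_group I G)" using grp by simp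
  ultimately show ?thesis
    unfolding group.trivial_group_subset[OF \<open>group (sum_group I G)\<close>]
    by (auto simp: trivial_group_def carrier_sum_group)
qed

text \<open>All coordinates other than \<open>i\<close> are forced to be the identity, so evaluation
  at \<open>i\<close> inverts the inclusion. Later this collapses a sum over all primes to one
  prime.\<close>

lemma sum_group_single:
  assumes grp: "\<And>i. i \<in> I \<Longrightarrow> group (G i)" and i: "i \<in> I"
    and triv: "\<And>j. j \<in> I \<Longrightarrow> j \<noteq> i \<Longrightarrow> trivial_group (G j)"
  shows "sum_group I G \<cong> G i"
proof -
  have "bij_betw (sum_inj I G i) (carrier (G i)) (carrier (sum_group I G))"
  proof (rule bij_betwI[where g = "\<lambda>x. x i"])
    show "sum_inj I G i \<in> carrier (G i) \<rightarrow> carrier (sum_group I G)"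
      using hom_in_carrier[OF sum_inj_hom[OF grp i]] by auto
    show "(\<lambda>x. x i) \<in> carrier (sum_group I G) \<rightarrow> carrier (G i)"
      using i by (auto simp: carrier_sum_group grp)
    show "sum_inj I G i a i = a" for a
      using i by (simp add: sum_inj_def)
    fix x assume "x \<in> carrier (sum_group I G)"
    then have x: "x \<in> (\<Pi>\<^sub>E j\<in>I. carrier (G j))" by (simp add: carrier_sum_group grp)
    show "sum_inj I G i (x i) = x"
    proof
      fix j
      show "sum_inj I G i (x i) j = x j"
      proof (cases "j \<in> I \<and> j \<noteq> i")
        case True
        then have "x j = \<one>\<^bsub>G j\<^esub>"
          using triv[of j] PiE_mem[OF x, of j] by (simp add: trivial_group_def)
        then show ?thesis using True by (simp add: sum_inj_def)
      next
        case False
        then consider "j = i" | "j \<notin> I" by blast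
        then show ?thesis
          using i PiE_arb[OF x, of j] by cases (simp_all add: sum_inj_def)
      qed
    qed
  qed
  then have "G i \<cong> sum_group I G"
    using sum_inj_hom[of I G i] grp i by (intro is_isoI isoI) blast+
  then show ?thesis by (rule group.iso_sym[OF grp[OF i]])
qed

section \<open>Isomorphisms of tensor products\<close>

lemma tensor_product_cong:
  assumes "group G" "group H" "group G'" "group H'" "G \<cong> G'" "H \<cong> H'"
  shows "tensor_product G H \<cong> tensor_product G' H'"
proof -
  interpret P: group_pair G H using assms by (simp add: group_pair_def)
  interpret Q: group_pair G' H' using assms by (simp add: group_pair_def)
  from assms obtain a where a: "a \<in> iso G G'" by (auto simp: is_iso_def)
  from assms obtain b where b: "b \<in> iso H H'" by (auto simp: is_iso_def)
  obtain a' where a': "group_isomorphisms G G' a a'"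
    using a assms(1) by (auto simp: group.iso_iff_group_isomorphisms)
  obtain b' where b': "group_isomorphisms H H' b b'"
    using b assms(2) by (auto simp: group.iso_iff_group_isomorphisms)
  \<comment> \<open>The backward map \<open>r\<close> is induced by the inverse isomorphisms
    \<open>a'\<close> and \<open>b'\<close>.\<close>
  have "bilinear_map G' H' P.T (\<lambda>g h. P.t (a' g) (b' h))"
    using a' b' by (intro bilinear_mapI)
      (auto simp: group_isomorphisms_def hom_in_carrier hom_mult hom_mult[OF bilinear_map_homs(1)[OF P.bilinear_tensor]]
        hom_mult[OF bilinear_map_homs(2)[OF P.bilinear_tensor]])
  then obtain r where r: "r \<in> hom Q.T P.T"
    "\<And>g h. g \<in> carrier G' \<Longrightarrow> h \<in> carrier H' \<Longrightarrow> r (Q.t g h) = P.t (a' g) (b' h)"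
    using Q.tensor_product_universal[OF P.comm_group_tensor_product] by blast
  show ?thesis
  proof (rule P.tensor_product_iso[OF Q.comm_group_tensor_product _ r(1)])
    show "bilinear_map G H Q.T (\<lambda>g h. Q.t (a g) (b h))"
      using a' b' by (intro bilinear_mapI)
        (auto simp: group_isomorphisms_def hom_in_carrier hom_mult hom_mult[OF bilinear_map_homs(1)[OF Q.bilinear_tensor]]
          hom_mult[OF bilinear_map_homs(2)[OF Q.bilinear_tensor]])
    show "r (Q.t (a g) (b h)) = P.t g h" if "g \<in> carrier G" "h \<in> carrier H" for g h
    proof -
      have "a g \<in> carrier G'" "b h \<in> carrier H'" "a' (a g) = g" "b' (b h) = h"
        using that a' b' by (auto simp: group_isomorphisms_def hom_in_carrier)
      then show ?thesis by (simp add: r(2))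
    qed
    \<comment> \<open>Surjectivity of \<open>a\<close> and \<open>b\<close>: every elementary tensor
      over \<open>G'\<close> and \<open>H'\<close> comes from one over \<open>G\<close> and
      \<open>H\<close>.\<close>
    have "{Q.t g h | g h. g \<in> carrier G' \<and> h \<in> carrier H'} \<subseteq>
        {Q.t (a g) (b h) | g h. g \<in> carrier G \<and> h \<in> carrier H}"
    proof clarify
      fix g h assume "g \<in> carrier G'" "h \<in> carrier H'"
      then have "a' g \<in> carrier G" "b' h \<in> carrier H" "a (a' g) = g" "b (b' h) = h"
        using a' b' by (auto simp: group_isomorphisms_def hom_in_carrier)
      then show "\<exists>g' h'. Q.t g h = Q.t (a g') (b h') \<and> g' \<in> carrier G \<and> h' \<in> carrier H"
        by metis
    qed
    then show "carrier Q.T \<subseteq> generate Q.T {Q.t (a g) (b h) | g h. g \<in> carrier G \<and> h \<in> carrier H}"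
      unfolding Q.tensor_product_generated by (rule Q.T.mono_generate)
  qed
qed

lemma tensor_product_commute:
  assumes "group G" "group H"
  shows "tensor_product G H \<cong> tensor_product H G"
proof -
  interpret P: group_pair G H using assms by (simp add: group_pair_def)
  interpret Q: group_pair H G using assms by (simp add: group_pair_def)
  \<comment> \<open>Swapping arguments is stated for arbitrary groups because it is applied in both
    directions.\<close>
  have flip: "bilinear_map H' G' K (\<lambda>h g. f g h)" if "bilinear_map G' H' K f"
    for G' :: "('x, 'p) monoid_scheme" and H' :: "('y, 'q) monoid_scheme" and K :: "('z, 'r) monoid_scheme" and f
    using that by (simp add: bilinear_map_def)
  obtain r where r: "r \<in> hom Q.T P.T"
    "\<And>h g. h \<in> carrier H \<Longrightarrow> g \<in> carrier G \<Longrightarrow> r (Q.t h g) = P.t g h"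
    using Q.tensor_product_universal[OF P.comm_group_tensor_product flip[OF P.bilinear_tensor]] by blast
  have "{Q.t h g | g h. g \<in> carrier G \<and> h \<in> carrier H} = {Q.t h g | h g. h \<in> carrier H \<and> g \<in> carrier G}"
    by blast
  then show ?thesis
    by (intro P.tensor_product_iso[OF Q.comm_group_tensor_product flip[OF Q.bilinear_tensor] r(1)])
       (auto simp: r(2) simp flip: Q.tensor_product_generated)
qed

text \<open>Forward, \<open>x\<close> and \<open>h\<close> go to the family of tensors of
  \<open>x i\<close> with \<open>h\<close>. Backward, the maps induced on the summands by the
  inclusions are multiplied together.\<close>

lemma tensor_product_sum_left:
  fixes G :: "'i \<Rightarrow> ('a, 'm) monoid_scheme"
  assumes G: "\<And>i. i \<in> I \<Longrightarrow> group (G i)" and H: "group H"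
  shows "tensor_product (sum_group I G) H \<cong> sum_group I (\<lambda>i. tensor_product (G i) H)"
proof -
  interpret P: group_pair "sum_group I G" H using G H by (simp add: group_pair_def)
  let ?Ti = "\<lambda>i. tensor_product (G i) H"
  let ?K = "sum_group I ?Ti"
  let ?f = "\<lambda>x h. \<lambda>i\<in>I. tensor (G i) H (x i) h"
  have pair: "group_pair (G i) H" if "i \<in> I" for i
    using G H that by (simp add: group_pair_def)
  have Ti: "group (?Ti i)" if "i \<in> I" for i
    using G H that by (simp add: group_tensor_product)
  note bil = group_pair.bilinear_tensor[OF pair]
  have K: "comm_group ?K"
    by (intro comm_group_sum_group group_pair.comm_group_tensor_product pair)
  \<comment> \<open>Tensoring with the identity is trivial, so the family \<open>?f x h\<close>
    inherits finite support from \<open>x\<close>.\<close>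
  have tensor_one: "tensor (G i) H \<one>\<^bsub>G i\<^esub> h = \<one>\<^bsub>?Ti i\<^esub>" if "i \<in> I" "h \<in> carrier H" for i h
    using hom_one[OF bilinear_map_homs(1)[OF bil[OF that(1)] that(2)] G Ti] that by blast
  have comp: "x i \<in> carrier (G i)" if "x \<in> carrier (sum_group I G)" "i \<in> I" for x i
    using that G by (auto simp: carrier_sum_group)
  have f: "bilinear_map (sum_group I G) H ?K ?f"
  proof (rule bilinear_mapI)
    fix x h assume x: "x \<in> carrier (sum_group I G)" and h: "h \<in> carrier H"
    have "{i \<in> I. ?f x h i \<noteq> \<one>\<^bsub>?Ti i\<^esub>} \<subseteq> {i \<in> I. x i \<noteq> \<one>\<^bsub>G i\<^esub>}"
      using tensor_one[OF _ h] by auto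
    then have "finite {i \<in> I. ?f x h i \<noteq> \<one>\<^bsub>?Ti i\<^esub>}"
      by (rule finite_subset) (use x G in \<open>simp add: carrier_sum_group\<close>)
    moreover have "?f x h \<in> (\<Pi>\<^sub>E i\<in>I. carrier (?Ti i))"
      using comp[OF x] h group_pair.tensor_closed[OF pair] by auto
    ultimately show "?f x h \<in> carrier ?K"
      using Ti by (simp add: carrier_sum_group)
  next
    fix x x' h assume "x \<in> carrier (sum_group I G)" "x' \<in> carrier (sum_group I G)" "h \<in> carrier H"
    then show "?f (x \<otimes>\<^bsub>sum_group I G\<^esub> x') h = ?f x h \<otimes>\<^bsub>?K\<^esub> ?f x' h"
      using comp by (auto intro!: restrict_ext simp: hom_mult[OF bilinear_map_homs(1)[OF bil]])
  next
    fix x h h' assume "x \<in> carrier (sum_group I G)" "h \<in> carrier H" "h' \<in> carrier H"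
    then show "?f x (h \<otimes>\<^bsub>H\<^esub> h') = ?f x h \<otimes>\<^bsub>?K\<^esub> ?f x h'"
      using comp by (auto intro!: restrict_ext simp: hom_mult[OF bilinear_map_homs(2)[OF bil]])
  qed
  have "\<exists>\<phi>. \<phi> \<in> hom (?Ti i) P.T \<and> (\<forall>g\<in>carrier (G i). \<forall>h\<in>carrier H.
      \<phi> (tensor (G i) H g h) = P.t (sum_inj I G i g) h)" if i: "i \<in> I" for i
  proof -
    note inj = sum_inj_hom[of I G, OF G i]
    have "bilinear_map (G i) H P.T (\<lambda>g h. P.t (sum_inj I G i g) h)"
      by (rule bilinear_mapI)
         (auto simp: hom_in_carrier[OF inj] hom_mult[OF inj] hom_mult[OF bilinear_map_homs(1)[OF P.bilinear_tensor]]
            hom_mult[OF bilinear_map_homs(2)[OF P.bilinear_tensor]] simp del: mult_sum_group)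
    then show ?thesis
      using group_pair.tensor_product_universal[OF pair[OF i] P.comm_group_tensor_product] by metis
  qed
  then obtain \<phi> where \<phi>: "\<And>i. i \<in> I \<Longrightarrow> \<phi> i \<in> hom (?Ti i) P.T"
    and \<phi>t: "\<And>i g h. i \<in> I \<Longrightarrow> g \<in> carrier (G i) \<Longrightarrow> h \<in> carrier H \<Longrightarrow>
        \<phi> i (tensor (G i) H g h) = P.t (sum_inj I G i g) h"
    by metis
  show ?thesis
  proof (rule P.tensor_product_iso[OF K f P.T.hom_group_sum[OF \<phi> Ti]])
    fix x h assume x: "x \<in> carrier (sum_group I G)" and h: "h \<in> carrier H"
    have "gfinprod P.T (\<lambda>i. \<phi> i (?f x h i)) I = gfinprod P.T (\<lambda>i. P.t (sum_inj I G i (x i)) h) I"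
      using comp[OF x] h
      by (intro P.T.gfinprod_cong) (auto simp: \<phi>t simp_implies_def hom_in_carrier[OF sum_inj_hom[of I G, OF G]])
    \<comment> \<open>The homomorphism \<open>P.t\<close> with second argument \<open>h\<close> is
      decomposed along the summands of \<open>x\<close>.\<close>
    also have "\<dots> = P.t x h"
      using P.T.hom_sum_group_eq_gfinprod[OF G bilinear_map_homs(1)[OF P.bilinear_tensor h] x] by simp
    finally show "gfinprod P.T (\<lambda>i. \<phi> i (?f x h i)) I = P.t x h" .
  next
    interpret K: comm_group ?K by (rule K)
    let ?S = "{?f x h | x h. x \<in> carrier (sum_group I G) \<and> h \<in> carrier H}"
    have S: "?S \<subseteq> carrier ?K"
      using hom_in_carrier[OF bilinear_map_homs(2)[OF f]] by blast
    \<comment> \<open>Each summand is generated by its own elementary tensors, so it suffices to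
      find their inclusions among the values of \<open>?f\<close>.\<close>
    have "sum_inj I ?Ti i ` carrier (?Ti i) \<subseteq> generate ?K ?S" if i: "i \<in> I" for i
    proof -
      interpret Pi: group_pair "G i" H by (rule pair[OF i])
      interpret j: group_hom "?Ti i" ?K "sum_inj I ?Ti i"
        using sum_inj_hom[of I ?Ti, OF Ti i] by unfold_locales
      let ?Si = "{Pi.t g h | g h. g \<in> carrier (G i) \<and> h \<in> carrier H}"
      have "sum_inj I ?Ti i ` carrier (?Ti i) = generate ?K (sum_inj I ?Ti i ` ?Si)"
        unfolding Pi.tensor_product_generated by (rule j.generate_img[symmetric]) auto
      also have "\<dots> \<subseteq> generate ?K ?S"
      proof (rule K.mono_generate, clarify)
        fix g h assume g: "g \<in> carrier (G i)" and h: "h \<in> carrier H"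
        \<comment> \<open>Away from \<open>i\<close> the right-hand side is a tensor with the
          identity, hence trivial.\<close>
        have "sum_inj I ?Ti i (Pi.t g h) = ?f (sum_inj I G i g) h"
          using h by (auto simp: sum_inj_def tensor_one intro!: restrict_ext)
        then show "\<exists>x h'. sum_inj I ?Ti i (Pi.t g h) = ?f x h' \<and> x \<in> carrier (sum_group I G) \<and> h' \<in> carrier H"
          using h hom_in_carrier[OF sum_inj_hom[of I G, OF G i] g] by blast
      qed
      finally show ?thesis .
    qed
    then have "generate ?K (\<Union>i\<in>I. sum_inj I ?Ti i ` carrier (?Ti i)) \<subseteq> generate ?K ?S"
      by (intro K.generate_subgroup_incl K.generate_is_subgroup S) blast
    moreover have "carrier ?K = generate ?K (\<Union>i\<in>I. sum_inj I ?Ti i ` carrier (?Ti i))"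
      by (rule sum_group_generated) (rule Ti)
    ultimately show "carrier ?K \<subseteq> generate ?K ?S" by simp
  qed
qed

lemma tensor_product_sum_right:
  assumes G: "group G" and H: "\<And>i. i \<in> I \<Longrightarrow> group (H i)"
  shows "tensor_product G (sum_group I H) \<cong> sum_group I (\<lambda>i. tensor_product G (H i))"
proof -
  have "tensor_product G (sum_group I H) \<cong> tensor_product (sum_group I H) G"
    using assms by (intro tensor_product_commute) auto
  also have "\<dots> \<cong> sum_group I (\<lambda>i. tensor_product (H i) G)"
    using assms by (intro tensor_product_sum_left) auto
  also have "\<dots> \<cong> sum_group I (\<lambda>i. tensor_product G (H i))"
    using assms by (intro iso_sum_groupI tensor_product_commute group_tensor_product) auto
  finally show ?thesis .
qed

text \<open>Multiplication modulo the gcd \<open>d\<close> respects residues modulo \<open>m\<close>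
  and \<open>n\<close>, as \<open>d\<close> divides both. Conversely the group is generated by the
  tensor \<open>u\<close> of the two unit residues, and \<open>u\<close> is killed by
  \<open>m\<close> and \<open>n\<close>, hence by \<open>d\<close>.\<close>

lemma tensor_product_integer_mod_group:
  "tensor_product (integer_mod_group m) (integer_mod_group n) \<cong> integer_mod_group (gcd m n)"
proof -
  interpret P: group_pair "integer_mod_group m" "integer_mod_group n"
    by (simp add: group_pair_def)
  let ?d = "gcd m n"
  let ?K = "integer_mod_group ?d"
  let ?f = "\<lambda>x y::int. x * y mod int ?d"
  have mod_closed: "k mod int l \<in> carrier (integer_mod_group l)" for k l
    by (simp add: carrier_integer_mod_group)
  have mod_mod: "k mod int m mod int ?d = k mod int ?d" "k mod int n mod int ?d = k mod int ?d" for k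
    by (simp_all add: mod_mod_cancel)
  have f: "bilinear_map (integer_mod_group m) (integer_mod_group n) ?K ?f"
  proof (rule bilinear_mapI)
    fix x x' y
    have "(x + x') mod int m * y mod int ?d = (x + x') * y mod int ?d"
      by (metis mod_mod(1) mod_mult_left_eq)
    then show "?f (x \<otimes>\<^bsub>integer_mod_group m\<^esub> x') y = ?f x y \<otimes>\<^bsub>?K\<^esub> ?f x' y"
      by (simp add: distrib_right mod_simps)
  next
    fix x y y'
    have "x * ((y + y') mod int n) mod int ?d = x * (y + y') mod int ?d"
      by (metis mod_mod(2) mod_mult_right_eq)
    then show "?f x (y \<otimes>\<^bsub>integer_mod_group n\<^esub> y') = ?f x y \<otimes>\<^bsub>?K\<^esub> ?f x y'"
      by (simp add: distrib_left mod_simps)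
  qed (rule mod_closed)
  \<comment> \<open>Writing \<open>1 mod int m\<close> instead of \<open>1\<close> keeps the element
    in the carrier when the modulus is 1; for modulus 0 it is still \<open>1\<close>.\<close>
  define u where "u = P.t (1 mod int m) (1 mod int n)"
  have u: "u \<in> carrier P.T" by (simp add: u_def mod_closed)
  have pow: "P.t (k mod int m) (l mod int n) = u [^]\<^bsub>P.T\<^esub> (k * l)" for k l :: int
  proof -
    have "u [^]\<^bsub>P.T\<^esub> (k * l) = (u [^]\<^bsub>P.T\<^esub> k) [^]\<^bsub>P.T\<^esub> l"
      using u by (simp add: P.T.int_pow_pow)
    also have "u [^]\<^bsub>P.T\<^esub> k = P.t ((1 mod int m) [^]\<^bsub>integer_mod_group m\<^esub> k) (1 mod int n)"
      unfolding u_def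
      using hom_int_pow[OF bilinear_map_homs(1)[OF P.bilinear_tensor]] mod_closed by auto
    also have "\<dots> [^]\<^bsub>P.T\<^esub> l = P.t ((1 mod int m) [^]\<^bsub>integer_mod_group m\<^esub> k)
        ((1 mod int n) [^]\<^bsub>integer_mod_group n\<^esub> l)"
      using hom_int_pow[OF bilinear_map_homs(2)[OF P.bilinear_tensor]] mod_closed
      by auto
    finally show ?thesis by (simp add: int_pow_integer_mod_group mod_simps)
  qed
  \<comment> \<open>The residues of \<open>m\<close> and of 0 modulo \<open>m\<close> coincide, so
    the exponents \<open>m * k\<close> and 0 give the same tensor.\<close>
  have pow_m: "u [^]\<^bsub>P.T\<^esub> (int m * k) = \<one>\<^bsub>P.T\<^esub>" for k
    using pow[of 0 k] pow[of "int m" k] by simp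
  have pow_n: "u [^]\<^bsub>P.T\<^esub> (int n * k) = \<one>\<^bsub>P.T\<^esub>" for k
    using pow[of k 0] pow[of k "int n"] by (simp add: mult.commute)
  \<comment> \<open>By Bezout, multiples of \<open>d\<close> are sums of multiples of
    \<open>m\<close> and of \<open>n\<close>.\<close>
  obtain a b where "a * int m + b * int n = int ?d"
    using bezout_int[of "int m" "int n"] by auto
  then have "int ?d * k = int m * (a * k) + int n * (b * k)" for k
    by (metis (no_types) distrib_right mult.assoc mult.left_commute)
  then have pow_d: "u [^]\<^bsub>P.T\<^esub> (int ?d * k) = \<one>\<^bsub>P.T\<^esub>" for k
    using u by (simp add: P.T.int_pow_mult pow_m pow_n)
  \<comment> \<open>Powers of \<open>u\<close> depend only on the exponent modulo \<open>d\<close>,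
    so \<open>k\<close> to \<open>u\<close> to the power \<open>k\<close> is well defined on
    residues.\<close>
  have pow_mod: "u [^]\<^bsub>P.T\<^esub> (k mod int ?d) = u [^]\<^bsub>P.T\<^esub> k" for k
  proof -
    have "u [^]\<^bsub>P.T\<^esub> k = u [^]\<^bsub>P.T\<^esub> (int ?d * (k div int ?d) + k mod int ?d)" by simp
    then show ?thesis using u by (simp only: P.T.int_pow_mult pow_d) simp
  qed
  show ?thesis
  proof (rule P.tensor_product_iso[OF _ f])
    show "comm_group ?K" by simp
    show "(\<lambda>k. u [^]\<^bsub>P.T\<^esub> k) \<in> hom ?K P.T"
      using u by (intro homI) (simp_all add: pow_mod P.T.int_pow_mult)
    show "u [^]\<^bsub>P.T\<^esub> ?f x y = P.t x y"
      if "x \<in> carrier (integer_mod_group m)" "y \<in> carrier (integer_mod_group n)" for x y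
    proof -
      have "x mod int m = x" "y mod int n = y"
        using that by (auto simp: carrier_integer_mod_group split: if_splits)
      then show ?thesis using pow[of x y] by (simp add: pow_mod)
    qed
    show "carrier ?K \<subseteq> generate ?K {?f x y | x y.
        x \<in> carrier (integer_mod_group m) \<and> y \<in> carrier (integer_mod_group n)}"
    proof
      fix k assume k: "k \<in> carrier ?K"
      \<comment> \<open>Every residue is itself a value of the pairing, with second argument the
        residue of 1.\<close>
      have "?f (k mod int m) (1 mod int n) = k mod int ?d"
        by (metis mod_mod mod_mult_eq mult.right_neutral)
      also have "\<dots> = k"
        using k by (auto simp: carrier_integer_mod_group split: if_splits)
      finally show "k \<in> generate ?K {?f x y | x y.
          x \<in> carrier (integer_mod_group m) \<and> y \<in> carrier (integer_mod_group n)}"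
        using mod_closed by (intro generate.incl) (smt (verit) mem_Collect_eq)
    qed
  qed
qed

section \<open>Primary decompositions\<close>

lemma group_multiset_sum_group:
  "(\<And>i. group (G i)) \<Longrightarrow> group (multiset_sum_group M G)"
  unfolding multiset_sum_group_def by (intro sum_group) auto

lemma iso_multiset_sum_groupI:
  assumes "\<And>i. G i \<cong> H i" "\<And>i. group (G i)" "\<And>i. group (H i)"
  shows "multiset_sum_group M G \<cong> multiset_sum_group M H"
  unfolding multiset_sum_group_def using assms by (intro iso_sum_groupI) auto

lemma trivial_multiset_sum_group:
  "(\<And>i. i \<in># M \<Longrightarrow> trivial_group (G i)) \<Longrightarrow> trivial_group (multiset_sum_group M G)"
  unfolding multiset_sum_group_def
  by (intro trivial_sum_group) (auto simp: count_greater_zero_iff[symmetric] simp del: count_greater_zero_iff)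

text \<open>A multiset sum is a direct sum over index pairs: distribute on the left, then on the
  right inside each summand. The two equalities only move the tensor product under the case
  distinction on the pair.\<close>

lemma tensor_product_multiset_sum_group:
  assumes G: "\<And>i. group (G i)" and H: "\<And>j. group (H j)"
  shows "tensor_product (multiset_sum_group M G) (multiset_sum_group N H) \<cong>
    multiset_sum_group M (\<lambda>i. multiset_sum_group N (\<lambda>j. tensor_product (G i) (H j)))"
proof -
  have "tensor_product (multiset_sum_group M G) (multiset_sum_group N H) \<cong>
      sum_group {(i, k). k < count M i} (\<lambda>x. tensor_product (case x of (i, k) \<Rightarrow> G i) (multiset_sum_group N H))"
    unfolding multiset_sum_group_def[of M]
    using G H by (intro tensor_product_sum_left group_multiset_sum_group) auto
  also have "\<dots> = multiset_sum_group M (\<lambda>i. tensor_product (G i) (multiset_sum_group N H))"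
    unfolding multiset_sum_group_def[of M]
    by (intro arg_cong[where f = "sum_group _"]) auto
  also have "\<dots> \<cong> multiset_sum_group M (\<lambda>i. multiset_sum_group N (\<lambda>j. tensor_product (G i) (H j)))"
  proof (intro iso_multiset_sum_groupI group_tensor_product group_multiset_sum_group G H)
    fix i
    have "tensor_product (G i) (multiset_sum_group N H) \<cong>
        sum_group {(j, k). k < count N j} (\<lambda>x. tensor_product (G i) (case x of (j, k) \<Rightarrow> H j))"
      unfolding multiset_sum_group_def using G H by (intro tensor_product_sum_right) auto
    also have "\<dots> = multiset_sum_group N (\<lambda>j. tensor_product (G i) (H j))"
      unfolding multiset_sum_group_def by (intro arg_cong[where f = "sum_group _"]) auto
    finally show "tensor_product (G i) (multiset_sum_group N H) \<cong>
        multiset_sum_group N (\<lambda>j. tensor_product (G i) (H j))" .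
  qed
  finally show ?thesis .
qed

text \<open>Stated for two bases so that it covers both the diagonal terms \<open>p = q\<close> and
  the mixed terms.\<close>

lemma tensor_product_primary:
  fixes p q :: nat
  shows "tensor_product (multiset_sum_group M (\<lambda>i. integer_mod_group (p ^ i)))
           (multiset_sum_group N (\<lambda>j. integer_mod_group (q ^ j))) \<cong>
         multiset_sum_group M (\<lambda>i. multiset_sum_group N (\<lambda>j. integer_mod_group (gcd (p ^ i) (q ^ j))))"
proof -
  have "tensor_product (multiset_sum_group M (\<lambda>i. integer_mod_group (p ^ i)))
           (multiset_sum_group N (\<lambda>j. integer_mod_group (q ^ j))) \<cong>
      multiset_sum_group M (\<lambda>i. multiset_sum_group N (\<lambda>j.
        tensor_product (integer_mod_group (p ^ i)) (integer_mod_group (q ^ j))))"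
    by (intro tensor_product_multiset_sum_group group_integer_mod_group)
  also have "\<dots> \<cong> multiset_sum_group M (\<lambda>i. multiset_sum_group N (\<lambda>j. integer_mod_group (gcd (p ^ i) (q ^ j))))"
    by (intro iso_multiset_sum_groupI tensor_product_integer_mod_group group_multiset_sum_group
        group_tensor_product group_integer_mod_group)
  finally show ?thesis .
qed

lemma gcd_power_power: "gcd (p ^ i) (p ^ j) = (p :: nat) ^ min i j"
  by (cases "i \<le> j") (simp_all add: le_imp_power_dvd min_def)

text \<open>Here \<open>C M p\<close> is the \<open>p\<close>-primary component. Distributing over
  both sums leaves, for each \<open>p\<close>, a sum over all primes \<open>q\<close>, of which only
  the term \<open>q = p\<close> survives.\<close>

lemma tensor_product_primary_decomposition:
  fixes MA MB :: "nat \<Rightarrow> nat multiset" and A :: "('c, 'k) monoid_scheme" and B :: "('d, 'l) monoid_scheme"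
  defines "C \<equiv> (\<lambda>M p. multiset_sum_group (M p) (\<lambda>i. integer_mod_group (p ^ i)))"
  assumes AB: "group A" "group B" "A \<cong> sum_group {p. prime p} (C MA)" "B \<cong> sum_group {p. prime p} (C MB)"
  shows "tensor_product A B \<cong> sum_group {p. prime p} (\<lambda>p.
    multiset_sum_group (MA p) (\<lambda>i. multiset_sum_group (MB p) (\<lambda>j. integer_mod_group (p ^ min i j))))"
proof -
  let ?P = "{p::nat. prime p}"
  have C: "group (C M p)" for M p
    unfolding C_def by (intro group_multiset_sum_group group_integer_mod_group)
  have "tensor_product A B \<cong> tensor_product (sum_group ?P (C MA)) (sum_group ?P (C MB))"
    using AB C by (intro tensor_product_cong) auto
  also have "\<dots> \<cong> sum_group ?P (\<lambda>p. tensor_product (C MA p) (sum_group ?P (C MB)))"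
    using C by (intro tensor_product_sum_left) auto
  also have "\<dots> \<cong> sum_group ?P (\<lambda>p. tensor_product (C MA p) (C MB p))"
  proof (rule iso_sum_groupI)
    fix p assume p: "p \<in> ?P"
    have "tensor_product (C MA p) (sum_group ?P (C MB)) \<cong> sum_group ?P (\<lambda>q. tensor_product (C MA p) (C MB q))"
      using C by (intro tensor_product_sum_right) auto
    also have "\<dots> \<cong> tensor_product (C MA p) (C MB p)"
    proof (rule sum_group_single[OF _ p])
      fix q assume q: "q \<in> ?P" "q \<noteq> p"
      then have "coprime p q" using p by (auto intro: primes_coprime)
      \<comment> \<open>Powers of distinct primes have gcd 1, so each cyclic summand of a mixed term
        has modulus 1 and is trivial.\<close>
      then have "gcd (p ^ i) (q ^ j) = 1" for i j
        by (metis coprime_iff_gcd_eq_1 coprime_power_left_iff coprime_power_right_iff)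
      then have "tensor_product (C MA p) (C MB q) \<cong>
          multiset_sum_group (MA p) (\<lambda>i. multiset_sum_group (MB q) (\<lambda>j. integer_mod_group 1))"
        using tensor_product_primary[of "MA p" p "MB q" q] by (simp add: C_def)
      moreover have "trivial_group (multiset_sum_group (MA p) (\<lambda>i. multiset_sum_group (MB q) (\<lambda>j. integer_mod_group 1)))"
        by (intro trivial_multiset_sum_group) (simp add: trivial_integer_mod_group)
      ultimately show "trivial_group (tensor_product (C MA p) (C MB q))"
        by (subst isomorphic_group_triviality)
           (auto intro: group_tensor_product C simp: trivial_group_def)
    qed (intro group_tensor_product C)
    finally show "tensor_product (C MA p) (sum_group ?P (C MB)) \<cong> tensor_product (C MA p) (C MB p)" .
  qed (intro group_tensor_product sum_group C)+
  \<comment> \<open>On the diagonal the gcd of two powers of \<open>p\<close> is the power with the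
    smaller exponent, whence \<open>min i j\<close>.\<close>
  also have "\<dots> \<cong> sum_group ?P (\<lambda>p.
      multiset_sum_group (MA p) (\<lambda>i. multiset_sum_group (MB p) (\<lambda>j. integer_mod_group (p ^ min i j))))"
    using tensor_product_primary[of "MA p" p "MB p" p for p]
    by (intro iso_sum_groupI group_tensor_product C group_multiset_sum_group group_integer_mod_group)
       (simp add: C_def gcd_power_power)
  finally show ?thesis .
qed

theorem lemma7:
  fixes G :: "('a, 'm) monoid_scheme" and H :: "('b, 'n) monoid_scheme"
    and A :: "('c, 'k) monoid_scheme" and B :: "('d, 'l) monoid_scheme"
    and MA MB :: "nat \<Rightarrow> nat multiset"
  shows "(group G \<and> finite (carrier G) \<and> group H \<and> finite (carrier H) \<longrightarrow>
            finite (carrier (tensor_product G H)))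
       \<and> (comm_group A \<and> finite (carrier A) \<and> comm_group B \<and> finite (carrier B)
          \<and> (\<forall>p. prime p \<longrightarrow> (\<forall>i \<in># MA p. 0 < i) \<and> (\<forall>j \<in># MB p. 0 < j))
          \<and> finite {p. prime p \<and> MA p \<noteq> {#}} \<and> finite {p. prime p \<and> MB p \<noteq> {#}}
          \<and> A \<cong> sum_group {p. prime p} (\<lambda>p. multiset_sum_group (MA p) (\<lambda>i. integer_mod_group (p ^ i)))
          \<and> B \<cong> sum_group {p. prime p} (\<lambda>p. multiset_sum_group (MB p) (\<lambda>j. integer_mod_group (p ^ j)))
          \<longrightarrow>
            tensor_product A B \<cong>
              sum_group {p. prime p} (\<lambda>p.
                multiset_sum_group (MA p) (\<lambda>i.
                  multiset_sum_group (MB p) (\<lambda>j. integer_mod_group (p ^ min i j)))))"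
proof (rule conjI; intro impI; elim conjE)
  assume "group G" "group H" "finite (carrier G)" "finite (carrier H)"
  then show "finite (carrier (tensor_product G H))"
    by (intro group_pair.finite_tensor_product group_pair.intro)
qed (rule tensor_product_primary_decomposition, simp_all only: comm_group.axioms)

end
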